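(* Let $n$ be a positive integer, let $\mathcal{F}$ be a family of subsets of $[n]$ with $m=|\mathcal{F}|$, let $t$ be a positive integer with $t\le \frac12\log_2 m$, and let $D$ be the set of integers $j$ with $|j|\le i$, where $i=\sqrt{\frac{3n\ln(2m)}{t}}$. Then $\beta_D(\mathcal{F})\le t$. Moreover, if $A_1',\dots,A_t'$ are chosen independently, each being a random subset of $[n]$ containing each point of $[n]$ independently with probability $1/2$, then $\{A_1',\dots,A_t'\}$ is a $D$-secting family for $\mathcal{F}$ with probability greater than $1/2$; hence repeating this random choice until success yields a $D$-secting family of cardinality $t$ after an expected number of at most two iterations.
   Context: For a positive integer $n$, $[n]=\{1,\dots,n\}$. For a set $D$ of integers and families $\mathcal{F},\mathcal{F}'$ of subsets of $[n]$, $\mathcal{F}'$ is called $D$-secting for $\mathcal{F}$ if for every $A\in\mathcal{F}$ there exists $A'\in\mathcal{F}'$ with $|A\cap A'|-|A\cap([n]\setminus A')|\in D$. $\beta_D(\mathcal{F})$ denotes the minimum cardinality of a $D$-secting family for $\mathcal{F}$. *)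

theory Defs
  imports "HOL-Probability.Probability" "HOL-Probability.Product_PMF" "HOL-Library.Extended_Nat"
begin

definition secting :: "nat \<Rightarrow> int set \<Rightarrow> nat set set \<Rightarrow> nat set set \<Rightarrow> bool" where
  "secting n D F F' \<longleftrightarrow> F' \<subseteq> Pow {1..n} \<and>
     (\<forall>A\<in>F. \<exists>A'\<in>F'. int (card (A \<inter> A')) - int (card (A \<inter> ({1..n} - A'))) \<in> D)"

text \<open>
  The minimum is taken in the extended naturals, so that it is \<open>\<infinity>\<close> (and not \<open>0\<close>) when no
  secting family exists. Every secting family is finite, being a subset of \<open>Pow {1..n}\<close>.
\<close>

definition \<beta> :: "nat \<Rightarrow> int set \<Rightarrow> nat set set \<Rightarrow> enat" where
  "\<beta> n D F = (INF F'\<in>{F'. secting n D F F'}. enat (card F'))"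

definition random_subset :: "nat \<Rightarrow> nat set pmf" where
  "random_subset n =
     map_pmf (\<lambda>c. {x\<in>{1..n}. c x}) (Pi_pmf {1..n} False (\<lambda>_. bernoulli_pmf (1/2)))"

definition random_subsets :: "nat \<Rightarrow> nat \<Rightarrow> (nat \<Rightarrow> nat set) pmf" where
  "random_subsets n t = Pi_pmf {1..t} {} (\<lambda>_. random_subset n)"

text \<open>Infinitely many independent rounds, each drawing a tuple of \<open>t\<close> random subsets.\<close>

definition rounds :: "nat \<Rightarrow> nat \<Rightarrow> (nat \<Rightarrow> nat \<Rightarrow> nat set) measure" where
  "rounds n t = PiM UNIV (\<lambda>_. measure_pmf (random_subsets n t))"

text \<open>
  Repeating until the drawn value satisfies \<open>P\<close>: the number of iterations performed
  (the rounds are numbered from \<open>0\<close>) and the value that the procedure returns.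
\<close>

definition iterations :: "('a \<Rightarrow> bool) \<Rightarrow> (nat \<Rightarrow> 'a) \<Rightarrow> ennreal" where
  "iterations P \<omega> = (if \<exists>k. P (\<omega> k) then of_nat (Suc (LEAST k. P (\<omega> k))) else \<infinity>)"

definition outcome :: "('a \<Rightarrow> bool) \<Rightarrow> (nat \<Rightarrow> 'a) \<Rightarrow> 'a" where
  "outcome P \<omega> = \<omega> (LEAST k. P (\<omega> k))"

end

theory Submission
  imports Defs "HOL-Probability.Hoeffding"
begin

text \<open>
  For \<open>A \<subseteq> [n]\<close> and a uniformly random \<open>A'\<close>, the size of \<open>A \<inter> A'\<close> is binomially distributed, so by
  Hoeffding's inequality the discrepancy exceeds \<open>i\<close> with probability at most
  \<open>2 exp (- i\<^sup>2 / (2 n)) = 2 (2 m) powr (- 3 / (2 t))\<close>. A union bound over \<open>F\<close> shows that \<open>t\<close> independent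
  sets fail with probability at most \<open>m 2\<^sup>t (2 m) powr (- 3 / 2) \<le> 1 / (2 sqrt 2) \<le> 3 / 8\<close>.
  Since \<open>4\<^sup>t \<le> m \<le> 2\<^sup>n\<close>, two of the sets coincide with probability at most \<open>t (t - 1) / 4\<^sup>t \<le> 1 / 8\<close>,
  so success with \<open>t\<close> distinct sets still has probability at least \<open>1 / 2\<close>. Finally, the waiting time
  is the sum over \<open>k\<close> of the indicators that the first \<open>k\<close> rounds all fail, and its expectation is
  therefore dominated by a geometric series.
\<close>

section \<open>Waiting time for the first success\<close>

lemma iterations_eq_suminf:
  "iterations P \<omega> = (\<Sum>k. indicator {\<omega>. \<forall>j\<in>{..<k}. \<omega> j \<in> {x. \<not> P x}} \<omega>)"
proof (cases "\<exists>k. P (\<omega> k)")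
  case True
  define l where "l = (LEAST k. P (\<omega> k))"
  have l: "P (\<omega> l)" using True unfolding l_def by (metis LeastI)
  have less: "\<not> P (\<omega> j)" if "j < l" for j
    using that not_less_Least unfolding l_def by blast
  \<comment> \<open>The empty condition at \<open>k = 0\<close> always holds, so the indices
    \<open>0..l\<close> contribute \<open>l + 1\<close>, the same offset as \<open>Suc\<close> in
    \<open>iterations\<close>.\<close>
  have eq: "indicator {\<omega>. \<forall>j\<in>{..<k}. \<omega> j \<in> {x. \<not> P x}} \<omega> = (if k \<in> {..l} then 1 else 0 :: ennreal)" for k
    using l less by (auto simp: indicator_def not_le)
  have "(\<Sum>k. if k \<in> {..l} then 1 else 0 :: ennreal) = (\<Sum>k\<in>{..l}. 1)"
    by (subst suminf_finite[of "{..l}"]) auto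
  then show ?thesis
    using True unfolding eq by (simp add: iterations_def l_def)
next
  case False
  have "(\<Sum>k. 1 :: ennreal) = \<infinity>"
    using summable_iff_suminf_neq_top[of "\<lambda>_. 1"] by (simp add: summable_const_iff)
  then show ?thesis
    using False by (simp add: iterations_def)
qed

text \<open>Independence bounds the probability that the first \<open>k\<close> rounds all fail by
  \<open>(1/2)^k\<close>, and these bounds sum to 2. A finite expectation makes the waiting time
  finite almost everywhere, so the least index in \<open>outcome\<close> is a genuine
  success.\<close>

lemma
  fixes p :: "'a pmf"
  assumes half: "measure_pmf.prob p {x. P x} \<ge> 1/2"
  defines "M \<equiv> PiM (UNIV :: nat set) (\<lambda>_. measure_pmf p)"
  shows nn_integral_iterations_le: "(\<integral>\<^sup>+\<omega>. iterations P \<omega> \<partial>M) \<le> 2"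
    and AE_iterations_finite: "AE \<omega> in M. iterations P \<omega> < \<infinity> \<and> P (outcome P \<omega>)"
proof -
  interpret product_prob_space "\<lambda>_::nat. measure_pmf p" UNIV
    by (intro product_prob_spaceI measure_pmf.prob_space_axioms)
  \<comment> \<open>Membership over a finite index set presents the event as a cylinder, whose
    measure \<open>emeasure_PiM_Collect\<close> computes.\<close>
  define E where "E k = {\<omega>. \<forall>j\<in>{..<k}. \<omega> j \<in> {x. \<not> P x}}" for k :: nat
  have E_eq: "E k = {\<omega>\<in>space M. \<forall>j\<in>{..<k}. \<omega> j \<in> {x. \<not> P x}}" for k
    by (auto simp: E_def M_def space_PiM)
  have sets_E [measurable]: "E k \<in> sets M" for k
    unfolding E_eq M_def
    by (intro sets.sets_Collect_finite_All sets_Collect_single'[where P = "\<lambda>x. x \<in> {x. \<not> P x}"]) auto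
  have "measure_pmf.prob p {x. \<not> P x} = 1 - measure_pmf.prob p {x. P x}"
    using measure_pmf.prob_compl[of "{x. P x}" p] by (simp add: Compl_eq_Diff_UNIV[symmetric] Collect_neg_eq)
  then have fail: "measure_pmf.prob p {x. \<not> P x} \<le> 1/2" using half by simp
  have em: "emeasure M (E k) \<le> ennreal ((1/2) ^ k)" for k
  proof -
    have "emeasure M (E k) = (\<Prod>j\<in>{..<k}. emeasure p {x. \<not> P x})"
      unfolding E_eq M_def by (rule emeasure_PiM_Collect) auto
    also have "\<dots> = ennreal (measure_pmf.prob p {x. \<not> P x} ^ k)"
      by (simp add: measure_pmf.emeasure_eq_measure ennreal_power)
    also have "\<dots> \<le> ennreal ((1/2) ^ k)"
      by (intro ennreal_leI power_mono fail) simp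
    finally show ?thesis .
  qed
  have it: "iterations P = (\<lambda>\<omega>. \<Sum>k. indicator (E k) \<omega>)"
    by (simp add: fun_eq_iff iterations_eq_suminf E_def)
  have meas: "iterations P \<in> borel_measurable M"
    unfolding it by measurable
  have "(\<integral>\<^sup>+\<omega>. iterations P \<omega> \<partial>M) = (\<Sum>k. emeasure M (E k))"
    unfolding it by (subst nn_integral_suminf) simp_all
  also have "\<dots> \<le> (\<Sum>k. ennreal ((1/2) ^ k))"
    by (intro suminf_le em) auto
  also have "\<dots> = ennreal 2"
    using geometric_sums[of "1/2 :: real"] by (intro suminf_ennreal_eq) auto
  finally show le: "(\<integral>\<^sup>+\<omega>. iterations P \<omega> \<partial>M) \<le> 2" by simp
  have "AE \<omega> in M. iterations P \<omega> \<noteq> \<infinity>"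
    using le by (intro nn_integral_PInf_AE meas) (auto simp: top_unique)
  then show "AE \<omega> in M. iterations P \<omega> < \<infinity> \<and> P (outcome P \<omega>)"
  proof eventually_elim
    case (elim \<omega>)
    then have "\<exists>k. P (\<omega> k)" by (auto simp: iterations_def split: if_splits)
    then have "P (outcome P \<omega>)" unfolding outcome_def by (rule LeastI_ex)
    with elim show ?case by (simp add: less_top)
  qed
qed

section \<open>Discrepancy of one random subset\<close>

lemma random_subset_conv_pmf_of_set: "random_subset n = pmf_of_set (Pow {1..n})"
  unfolding random_subset_def by (rule pmf_of_set_Pow_conv_bernoulli) simp

lemma set_pmf_random_subset: "set_pmf (random_subset n) = Pow {1..n}"
  unfolding random_subset_conv_pmf_of_set by (subst set_pmf_of_set) auto

text \<open>Fair coins on \<open>[n]\<close>, restricted to \<open>A\<close>, are independent fair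
  coins on \<open>A\<close>, and the intersection counts their heads.\<close>

lemma map_card_Int_random_subset:
  assumes A: "A \<subseteq> {1..n}"
  shows "map_pmf (\<lambda>S. card (A \<inter> S)) (random_subset n) = binomial_pmf (card A) (1/2)"
proof -
  have fin: "finite A" using A finite_subset by blast
  have "binomial_pmf (card A) (1/2) =
      map_pmf (\<lambda>f. card {x\<in>A. f x}) (Pi_pmf A False (\<lambda>_. bernoulli_pmf (1/2)))"
    by (rule binomial_pmf_altdef') (auto simp: fin)
  also have "\<dots> = map_pmf (\<lambda>f. card {x\<in>A. f x}) (Pi_pmf {1..n} False (\<lambda>_. bernoulli_pmf (1/2)))"
    by (subst Pi_pmf_subset[OF _ A]) (auto simp: map_pmf_comp intro!: map_pmf_cong arg_cong[of _ _ card])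
  also have "\<dots> = map_pmf (\<lambda>S. card (A \<inter> S)) (random_subset n)"
    unfolding random_subset_def map_pmf_comp
    by (intro map_pmf_cong refl arg_cong[of _ _ card]) (use A in auto)
  finally show ?thesis ..
qed

definition disc :: "nat \<Rightarrow> nat set \<Rightarrow> nat set \<Rightarrow> int" where
  "disc n A S = int (card (A \<inter> S)) - int (card (A \<inter> ({1..n} - S)))"

text \<open>\<open>S\<close> and its complement split \<open>A\<close>. The discrepancy is thus
  twice the deviation of \<open>card (A \<inter> S)\<close> from its mean \<open>card A / 2\<close>,
  so Hoeffding's inequality is applied with threshold \<open>i/2\<close>.\<close>

lemma disc_eq:
  assumes A: "A \<subseteq> {1..n}"
  shows "disc n A S = 2 * int (card (A \<inter> S)) - int (card A)"
proof -
  have fin: "finite A" using A finite_subset by blast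
  have "card A = card (A \<inter> S) + card (A \<inter> ({1..n} - S))"
    using fin A by (subst card_Un_disjoint[symmetric]) (auto intro!: arg_cong[of _ _ card])
  then show ?thesis by (simp add: disc_def)
qed

lemma prob_disc_gt:
  assumes A: "A \<subseteq> {1..n}" and i: "i \<ge> 0"
  shows "measure_pmf.prob (random_subset n) {S. \<bar>real_of_int (disc n A S)\<bar> > i}
    \<le> 2 * exp (- i\<^sup>2 / (2 * real n))"
\<comment> \<open>The empty set has discrepancy 0. It is split off because division by
  \<open>card A = 0\<close> yields 0, which would spoil the final comparison of exponents.\<close>
proof (cases "A = {}")
  case True
  then have "{S. \<bar>real_of_int (disc n A S)\<bar> > i} = {}"
    using i by (auto simp: disc_def)
  then show ?thesis by simp
next
  case False
  have fin: "finite A" using A finite_subset by blast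
  have k0: "card A > 0" using False fin by (simp add: card_gt_0_iff)
  have kn: "card A \<le> n" using card_mono[OF _ A] by simp
  interpret binomial_distribution "card A" "1/2" by unfold_locales simp
  have "measure_pmf.prob (random_subset n) {S. \<bar>real_of_int (disc n A S)\<bar> > i}
      \<le> measure_pmf.prob (random_subset n)
          ((\<lambda>S. card (A \<inter> S)) -` {x. \<bar>real x - real (card A) * (1/2)\<bar> \<ge> i/2})"
    by (intro measure_pmf.finite_measure_mono) (auto simp: disc_eq[OF A] abs_if split: if_splits)
  also have "\<dots> = measure_pmf.prob (binomial_pmf (card A) (1/2))
      {x. \<bar>real x - real (card A) * (1/2)\<bar> \<ge> i/2}"
    unfolding map_card_Int_random_subset[OF A, symmetric] by simp
  also have "\<dots> \<le> 2 * exp (-2 * (i/2)\<^sup>2 / real (card A))"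
    by (rule prob_abs_ge) (use k0 i in auto)
  also have "-2 * (i/2)\<^sup>2 / real (card A) = - (i\<^sup>2 / (2 * real (card A)))"
    by (simp add: power2_eq_square field_simps)
  \<comment> \<open>Replacing \<open>card A\<close> by \<open>n\<close> makes the bound uniform in
    \<open>A\<close>, ready for the union bound.\<close>
  also have "2 * exp (- (i\<^sup>2 / (2 * real (card A)))) \<le> 2 * exp (- i\<^sup>2 / (2 * real n))"
    using k0 kn by (auto intro!: divide_left_mono)
  finally show ?thesis .
qed

section \<open>Union bounds for failure and for coinciding sets\<close>

lemma prob_not_secting_le:
  assumes F: "F \<subseteq> Pow {1..n}" and i: "i \<ge> 0" and D: "D = {j. \<bar>real_of_int j\<bar> \<le> i}"
  shows "measure_pmf.prob (random_subsets n t) {A'. \<not> secting n D F (A' ` {1..t})}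
    \<le> real (card F) * (2 * exp (- i\<^sup>2 / (2 * real n))) ^ t"
proof -
  let ?B = "\<lambda>A. Pi {1..t} (\<lambda>_. {S. \<bar>real_of_int (disc n A S)\<bar> > i})"
  have fin: "finite F" using F finite_subset by (metis finite_Pow_iff finite_atLeastAtMost)
  have "measure_pmf.prob (random_subsets n t) {A'. \<not> secting n D F (A' ` {1..t})}
      \<le> measure_pmf.prob (random_subsets n t) (\<Union>A\<in>F. ?B A)"
  \<comment> \<open>On the support all drawn sets lie in \<open>[n]\<close>, so failure can only
    come from some \<open>A\<close> on which all \<open>t\<close> sets have large
    discrepancy.\<close>
  proof (intro measure_pmf.finite_measure_mono_AE AE_pmfI impI)
    fix f assume f: "f \<in> set_pmf (random_subsets n t)" "f \<in> {A'. \<not> secting n D F (A' ` {1..t})}"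
    have "f ` {1..t} \<subseteq> Pow {1..n}"
      using f(1) by (auto simp: random_subsets_def set_Pi_pmf PiE_dflt_def set_pmf_random_subset)
    then show "f \<in> (\<Union>A\<in>F. ?B A)"
      using f(2) by (auto simp: secting_def D disc_def not_le)
  qed auto
  also have "\<dots> \<le> (\<Sum>A\<in>F. measure_pmf.prob (random_subsets n t) (?B A))"
    by (rule measure_pmf.finite_measure_subadditive_finite) (auto simp: fin)
  also have "\<dots> \<le> (\<Sum>A\<in>F. (2 * exp (- i\<^sup>2 / (2 * real n))) ^ t)"
  proof (rule sum_mono)
    fix A assume "A \<in> F"
    then have "measure_pmf.prob (random_subset n) {S. \<bar>real_of_int (disc n A S)\<bar> > i}
        \<le> 2 * exp (- i\<^sup>2 / (2 * real n))"
      using F i by (intro prob_disc_gt) auto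
    then show "measure_pmf.prob (random_subsets n t) (?B A) \<le> (2 * exp (- i\<^sup>2 / (2 * real n))) ^ t"
      unfolding random_subsets_def
      using power_mono[of _ "2 * exp (- i\<^sup>2 / (2 * real n))" t]
      by (subst measure_Pi_pmf_Pi) simp_all
  qed
  finally show ?thesis by simp
qed

text \<open>Union bound over ordered pairs of indices and over their common value \<open>S\<close>.
  Fixing \<open>S\<close> makes each event a product set of probability \<open>1 / 4^n\<close>, and
  there are \<open>2^n\<close> choices of \<open>S\<close> for each pair.\<close>

lemma prob_collision_le:
  "measure_pmf.prob (random_subsets n t) {A'. card (A' ` {1..t}) \<noteq> t} \<le> real (t * (t - 1)) / 2 ^ n"
proof -
  let ?I = "SIGMA a:{1..t}. {1..t} - {a}"
  let ?C = "\<lambda>((a, b), S). Pi {1..t} (\<lambda>x. if x \<in> {a, b} then {S} else UNIV)"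
  have "measure_pmf.prob (random_subsets n t) {A'. card (A' ` {1..t}) \<noteq> t}
      \<le> measure_pmf.prob (random_subsets n t) (\<Union>x\<in>?I \<times> Pow {1..n}. ?C x)"
  proof (intro measure_pmf.finite_measure_mono_AE AE_pmfI impI)
    fix f assume f: "f \<in> set_pmf (random_subsets n t)" "f \<in> {A'. card (A' ` {1..t}) \<noteq> t}"
    have sub: "f ` {1..t} \<subseteq> Pow {1..n}"
      using f(1) by (auto simp: random_subsets_def set_Pi_pmf PiE_dflt_def set_pmf_random_subset)
    have "\<not> inj_on f {1..t}" using f(2) by (auto dest: card_image)
    then obtain a b where "a \<in> {1..t}" "b \<in> {1..t}" "a \<noteq> b" "f a = f b"
      by (auto simp: inj_on_def)
    then have "((a, b), f a) \<in> ?I \<times> Pow {1..n}" "f \<in> ?C ((a, b), f a)"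
      using sub by (auto simp: image_subset_iff)
    then show "f \<in> (\<Union>x\<in>?I \<times> Pow {1..n}. ?C x)" by blast
  qed auto
  also have "\<dots> \<le> (\<Sum>x\<in>?I \<times> Pow {1..n}. measure_pmf.prob (random_subsets n t) (?C x))"
    by (rule measure_pmf.finite_measure_subadditive_finite) auto
  also have "\<dots> = (\<Sum>x\<in>?I \<times> Pow {1..n}. 1 / 4 ^ n)"
  proof (rule sum.cong)
    fix x assume "x \<in> ?I \<times> Pow {1..n}"
    then obtain a b S where x: "x = ((a, b), S)"
      and ab: "a \<in> {1..t}" "b \<in> {1..t}" "b \<noteq> a" and S: "S \<subseteq> {1..n}"
      by blast
    have one: "measure_pmf.prob (random_subset n) {S} = 1 / 2 ^ n"
      using S unfolding random_subset_conv_pmf_of_set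
      by (subst measure_pmf_single, subst pmf_of_set) (auto simp: card_Pow)
    have "measure_pmf.prob (random_subsets n t) (?C ((a, b), S))
        = (\<Prod>x\<in>{1..t}. if x \<in> {a, b} then 1 / 2 ^ n else 1)"
      unfolding random_subsets_def prod.case
      by (subst measure_Pi_pmf_Pi) (auto intro!: prod.cong simp: one)
    also have "\<dots> = (\<Prod>x\<in>{a, b}. 1 / 2 ^ n)"
      using ab by (intro prod.mono_neutral_cong_right) auto
    also have "\<dots> = 1 / 4 ^ n"
      using ab by (auto simp: power_mult_distrib[symmetric])
    finally show "measure_pmf.prob (random_subsets n t) (?C x) = 1 / 4 ^ n" unfolding x .
  qed simp
  also have "\<dots> = real (card (?I \<times> Pow {1..n})) / 4 ^ n" by simp
  also have "card (?I \<times> Pow {1..n}) = t * (t - 1) * 2 ^ n"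
    by (subst card_cartesian_product) (simp add: card_Pow)
  also have "real (t * (t - 1) * 2 ^ n) / 4 ^ n = real (t * (t - 1)) / 2 ^ n"
  proof -
    have "(4::real) ^ n = 2 ^ n * 2 ^ n" by (simp add: power_mult_distrib[symmetric])
    then show ?thesis by simp
  qed
  finally show ?thesis .
qed

section \<open>Numerical estimates\<close>

lemma eight_mult_pred_le_power4: "8 * (t * (t - 1)) \<le> (4::nat) ^ t"
proof (cases "t \<ge> 2")
  case True
  then show ?thesis
  proof (induction t rule: dec_induct)
    case (step t)
    \<comment> \<open>This uses \<open>t + 1 \<le> 4 * (t - 1)\<close>, valid from
      \<open>t = 2\<close> on; at \<open>t = 2\<close> the claimed bound is an equality.\<close>
    have "Suc t * t \<le> 4 * (t * (t - 1))"
      using mult_le_mono1[of "Suc t" "4 * (t - 1)" t] step.hyps by (simp add: algebra_simps)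
    with step.IH show ?case by simp
  qed simp
next
  case False
  then have "t = 0 \<or> t = 1" by auto
  then show ?thesis by auto
qed

text \<open>The exponent is \<open>- i^2 / (2 * n)\<close> for the \<open>i\<close> of the theorem.
  Its \<open>t\<close>-th power turns the exponential into \<open>(2 * m) powr (- 3/2)\<close>,
  leaving \<open>2^t / (2 * sqrt (2 * m))\<close>, where \<open>2^t \<le> sqrt m\<close>.\<close>

lemma union_bound_le:
  fixes m t :: nat
  assumes t: "t > 0" and m: "4 ^ t \<le> m"
  shows "real m * (2 * exp (- (3 * ln (2 * real m) / (2 * real t)))) ^ t \<le> 3/8"
proof -
  have m0: "real m > 0" using m by (metis less_le_trans of_nat_0_less_iff zero_less_numeral zero_less_power)
  have "exp (- (3 * ln (2 * real m) / (2 * real t))) ^ t = exp (- (3/2 * ln (2 * real m)))"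
    using t by (simp add: exp_of_nat_mult[symmetric])
  also have "\<dots> = (2 * real m) powr (- (1 + 1/2))"
    using m0 by (simp add: powr_def)
  also have "\<dots> = 1 / (2 * real m * sqrt (2 * real m))"
    using m0 by (simp only: powr_minus powr_add powr_half_sqrt) (simp add: field_simps)
  finally have e: "exp (- (3 * ln (2 * real m) / (2 * real t))) ^ t = 1 / (2 * real m * sqrt (2 * real m))" .
  have "(2 ^ t)\<^sup>2 = (4::real) ^ t" by (simp add: power_mult[symmetric] power2_eq_square power_mult_distrib[symmetric])
  also have "\<dots> \<le> real m" using m by (metis of_nat_le_iff of_nat_numeral of_nat_power)
  \<comment> \<open>\<open>4/3\<close> is a rational lower bound for \<open>sqrt 2\<close>; it
    produces the constant \<open>3/8\<close>, which leaves \<open>1/8\<close> for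
    coincidences.\<close>
  finally have "(4/3 * 2 ^ t)\<^sup>2 \<le> 2 * real m" using m0 by (simp add: power_mult_distrib power2_eq_square)
  then have s: "4/3 * 2 ^ t \<le> sqrt (2 * real m)" by (rule real_le_rsqrt)
  have "real m * (2 * exp (- (3 * ln (2 * real m) / (2 * real t)))) ^ t = 2 ^ t / (2 * sqrt (2 * real m))"
    unfolding power_mult_distrib e using m0 by (simp add: field_simps)
  also have "\<dots> \<le> 3/8"
    using s m0 by (simp add: field_simps)
  finally show ?thesis .
qed

section \<open>Success probabilities and conclusion\<close>

theorem theorem2:
  fixes n m t :: nat and F :: "nat set set" and D :: "int set" and i :: real
  assumes "n > 0"
    and "F \<subseteq> Pow {1..n}"
    and "m = card F"
    and "t > 0"
    and "real t \<le> 1/2 * log 2 (real m)"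
    and "i = sqrt (3 * real n * ln (2 * real m) / real t)"
    and "D = {j. \<bar>real_of_int j\<bar> \<le> i}"
  shows "\<beta> n D F \<le> enat t
    \<and> measure_pmf.prob (random_subsets n t) {A'. secting n D F (A' ` {1..t})} > 1/2
    \<and> (let success = (\<lambda>A'. secting n D F (A' ` {1..t})) in
         (AE \<omega> in rounds n t. iterations success \<omega> < \<infinity> \<and>
            secting n D F (outcome success \<omega> ` {1..t}))
         \<and> (\<integral>\<^sup>+\<omega>. iterations success \<omega> \<partial>rounds n t) \<le> 2)
    \<and> (let success = (\<lambda>A'. secting n D F (A' ` {1..t}) \<and> card (A' ` {1..t}) = t) in
         (AE \<omega> in rounds n t. iterations success \<omega> < \<infinity> \<and>
            secting n D F (outcome success \<omega> ` {1..t}) \<and>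
            card (outcome success \<omega> ` {1..t}) = t)
         \<and> (\<integral>\<^sup>+\<omega>. iterations success \<omega> \<partial>rounds n t) \<le> 2)"
proof -
  \<comment> \<open>For \<open>m = 0\<close> the convention \<open>ln 0 = 0\<close> makes the
    logarithm 0, contradicting \<open>t > 0\<close>.\<close>
  have m0: "m > 0"
    using assms(4,5) by (cases "m = 0") (auto simp: log_def)
  have "2 * real t \<le> log 2 (real m)" using assms(5) by simp
  then have "2 powr (2 * real t) \<le> real m" using m0 by (simp add: le_log_iff)
  moreover have "2 powr (2 * real t) = real (4 ^ t)"
    by (simp add: powr_powr[symmetric] powr_realpow[symmetric])
  ultimately have m4: "4 ^ t \<le> m" by (metis of_nat_le_iff)
  \<comment> \<open>Since \<open>F\<close> consists of subsets of \<open>[n]\<close>, the bound on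
    \<open>t\<close> also gives \<open>4^t \<le> 2^n\<close>, which controls coincidences among the
    drawn sets.\<close>
  have "m \<le> 2 ^ n"
    using card_mono[OF _ assms(2)] assms(3) by (simp add: card_Pow)
  with m4 have n4: "real (4 ^ t) \<le> 2 ^ n"
    by (metis le_trans of_nat_le_iff of_nat_numeral of_nat_power)
  have arg0: "0 \<le> 3 * real n * ln (2 * real m) / real t" using m0 by simp
  then have i0: "i \<ge> 0" by (simp add: assms(6))
  have "- i\<^sup>2 / (2 * real n) = - (3 * ln (2 * real m) / (2 * real t))"
    using arg0 assms(1,4) unfolding assms(6) by (simp add: field_simps)
  then have fail: "measure_pmf.prob (random_subsets n t) {A'. \<not> secting n D F (A' ` {1..t})} \<le> 3/8"
    using prob_not_secting_le[OF assms(2) i0 assms(7), of t] union_bound_le[OF assms(4) m4] assms(3)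
    by simp
  have "8 * real (t * (t - 1)) \<le> real (4 ^ t)"
    using eight_mult_pred_le_power4[of t] by (metis of_nat_le_iff of_nat_mult of_nat_numeral)
  then have "real (t * (t - 1)) / 2 ^ n \<le> 1/8" using n4 by (simp add: field_simps)
  then have coll: "measure_pmf.prob (random_subsets n t) {A'. card (A' ` {1..t}) \<noteq> t} \<le> 1/8"
    using prob_collision_le[of n t] by linarith
  have compl: "measure_pmf.prob p {x. P x} = 1 - measure_pmf.prob p {x. \<not> P x}"
    for p :: "(nat \<Rightarrow> nat set) pmf" and P
    using measure_pmf.prob_compl[of "{x. \<not> P x}" p]
    by (simp add: Compl_eq_Diff_UNIV[symmetric] Collect_neg_eq)
  have S1: "measure_pmf.prob (random_subsets n t) {A'. secting n D F (A' ` {1..t})} > 1/2"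
    using fail by (subst compl) simp
  \<comment> \<open>Drawn sets may coincide, so cardinality exactly \<open>t\<close> is a further
    requirement. The two failure bounds add up to \<open>3/8 + 1/8 = 1/2\<close>, hence the weak
    inequality in \<open>S2\<close>.\<close>
  have "measure_pmf.prob (random_subsets n t)
          {A'. \<not> (secting n D F (A' ` {1..t}) \<and> card (A' ` {1..t}) = t)}
      \<le> measure_pmf.prob (random_subsets n t) {A'. \<not> secting n D F (A' ` {1..t})}
        + measure_pmf.prob (random_subsets n t) {A'. card (A' ` {1..t}) \<noteq> t}"
    by (rule order_trans[OF _ measure_Un_le])
       (auto intro!: measure_pmf.finite_measure_mono)
  then have S2: "measure_pmf.prob (random_subsets n t)
      {A'. secting n D F (A' ` {1..t}) \<and> card (A' ` {1..t}) = t} \<ge> 1/2"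
    using fail coll by (subst compl) simp
  \<comment> \<open>Positive probability yields a secting family; as an image of
    \<open>{1..t}\<close> it has at most \<open>t\<close> members, which suffices for the
    minimum.\<close>
  have "{A'. secting n D F (A' ` {1..t})} \<noteq> {}"
    using S1 by (metis measure_empty not_less zero_le_divide_1_iff zero_le_numeral)
  then obtain A' where A': "secting n D F (A' ` {1..t})" by auto
  have "\<beta> n D F \<le> enat (card (A' ` {1..t}))"
    unfolding \<beta>_def by (rule INF_lower) (use A' in simp)
  also have "\<dots> \<le> enat t" using card_image_le[of "{1..t}" A'] by simp
  finally have "\<beta> n D F \<le> enat t" .
  then show ?thesis
    using S1 AE_iterations_finite[OF less_imp_le[OF S1]] nn_integral_iterations_le[OF less_imp_le[OF S1]]
      AE_iterations_finite[OF S2] nn_integral_iterations_le[OF S2]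
    unfolding rounds_def Let_def by simp
qed

end
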